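(* Let $c\neq 0$ and $\lambda>0$ be real constants, let $I\subset\mathbb{R}$ be an open interval on which $\cos\left(\frac{u}{c}\right)\neq0$ and $1-\frac{\lambda^2}{c^2}\sin^2\left(\frac{u}{c}\right)>0$, and let $\alpha:I\to\mathbb{R}$ be a smooth function. Then the generalized spherical surface of first kind in $\mathbb{E}^4$ determined by $c,\lambda,\alpha$ has flat normal connection, i.e., $K_N=0$.
   Context: The generalized spherical surface of first kind determined by $c,\lambda,\alpha$ is the surface in $\mathbb{E}^4$ given by the patch $$X(u,v)=\left(f_1(u),\ f_2(u),\ \lambda\cos\left(\tfrac{u}{c}\right)\cos v,\ \lambda\cos\left(\tfrac{u}{c}\right)\sin v\right),\qquad u\in I,\ v\in\mathbb{R},$$ where $f_1(u)=\int\sqrt{1-\frac{\lambda^2}{c^2}\sin^2\left(\frac{u}{c}\right)}\cos\alpha(u)\,du$ and $f_2(u)=\int\sqrt{1-\frac{\lambda^2}{c^2}\sin^2\left(\frac{u}{c}\right)}\sin\alpha(u)\,du$ (any antiderivatives). For a surface in $\mathbb{E}^4$ with orthonormal tangent frame $X_1,X_2$, orthonormal normal frame $N_1,N_2$, second fundamental form $h$ and shape operators $A_{N_\alpha}$ (defined by $\langle A_{N_\alpha}Y,Z\rangle=\langle h(Y,Z),N_\alpha\rangle$), the normal curvature tensor is $R^\perp(X_i,X_j)N_\alpha=h(X_i,A_{N_\alpha}X_j)-h(X_j,A_{N_\alpha}X_i)$, and the normal curvature is $K_N=\left\{\langle R^\perp(X_1,X_2)N_1,N_2\rangle^2\right\}^{1/2}$.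 The normal connection is flat if and only if $K_N=0$. *)

theory Defs
  imports "HOL-Analysis.Analysis"
begin

text \<open>Smoothness, for open \<open>S\<close>: the derivatives of all orders exist on \<open>S\<close>.\<close>

definition smooth_on :: "(real \<Rightarrow> real) \<Rightarrow> real set \<Rightarrow> bool" where
  "smooth_on f S \<longleftrightarrow> (\<forall>k. \<forall>x\<in>S. (deriv ^^ k) f differentiable (at x))"

type_synonym patch = "real \<Rightarrow> real \<Rightarrow> real^4"

definition partial_u :: "patch \<Rightarrow> patch" where
  "partial_u X u v = vector_derivative (\<lambda>s. X s v) (at u)"

definition partial_v :: "patch \<Rightarrow> patch" where
  "partial_v X u v = vector_derivative (\<lambda>t. X u t) (at v)"

definition tangent_plane :: "patch \<Rightarrow> real \<Rightarrow> real \<Rightarrow> (real^4) set" where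
  "tangent_plane X u v = span {partial_u X u v, partial_v X u v}"

definition normal_plane :: "patch \<Rightarrow> real \<Rightarrow> real \<Rightarrow> (real^4) set" where
  "normal_plane X u v = (tangent_plane X u v)\<^sup>\<bottom>"

definition normal_part :: "patch \<Rightarrow> real \<Rightarrow> real \<Rightarrow> real^4 \<Rightarrow> real^4" where
  "normal_part X u v w = (THE n. n \<in> normal_plane X u v \<and> w - n \<in> tangent_plane X u v)"

text \<open>The coordinates of a tangent vector in the basis \<open>X\<^sub>u, X\<^sub>v\<close>; they are unique
  wherever the patch is regular.\<close>

definition tangent_coords :: "patch \<Rightarrow> real \<Rightarrow> real \<Rightarrow> real^4 \<Rightarrow> real \<times> real" where
  "tangent_coords X u v Y =
     (THE (a, b). Y = a *\<^sub>R partial_u X u v + b *\<^sub>R partial_v X u v)"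

text \<open>The Gauss formula: \<open>h(Y, Z)\<close> is the normal part of the Euclidean derivative
  in direction \<open>Y\<close> of a tangent field extending \<open>Z\<close>. For \<open>Y = a X\<^sub>u + b X\<^sub>v\<close> and
  \<open>Z = p X\<^sub>u + q X\<^sub>v\<close> the extension used is the one with constant coefficients \<open>p\<close>, \<open>q\<close>;
  the normal part does not depend on the choice of the extension.\<close>

definition second_fundamental_form ::
  "patch \<Rightarrow> real \<Rightarrow> real \<Rightarrow> real^4 \<Rightarrow> real^4 \<Rightarrow> real^4" where
  "second_fundamental_form X u v Y Z =
     (let (a, b) = tangent_coords X u v Y; (p, q) = tangent_coords X u v Z
      in normal_part X u v
           ((a * p) *\<^sub>R partial_u (partial_u X) u v + (a * q) *\<^sub>R partial_u (partial_v X) u v +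
            (b * p) *\<^sub>R partial_v (partial_u X) u v + (b * q) *\<^sub>R partial_v (partial_v X) u v))"

definition shape_operator ::
  "patch \<Rightarrow> real \<Rightarrow> real \<Rightarrow> real^4 \<Rightarrow> real^4 \<Rightarrow> real^4" where
  "shape_operator X u v N Y =
     (THE W. W \<in> tangent_plane X u v \<and>
        (\<forall>Z\<in>tangent_plane X u v. W \<bullet> Z = second_fundamental_form X u v Y Z \<bullet> N))"

definition normal_curvature_tensor ::
  "patch \<Rightarrow> real \<Rightarrow> real \<Rightarrow> real^4 \<Rightarrow> real^4 \<Rightarrow> real^4 \<Rightarrow> real^4" where
  "normal_curvature_tensor X u v Y Z N =
     second_fundamental_form X u v Y (shape_operator X u v N Z) -
     second_fundamental_form X u v Z (shape_operator X u v N Y)"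

definition orthonormal_frame :: "(real^4) set \<Rightarrow> real^4 \<Rightarrow> real^4 \<Rightarrow> bool" where
  "orthonormal_frame V E1 E2 \<longleftrightarrow>
     E1 \<in> V \<and> E2 \<in> V \<and> norm E1 = 1 \<and> norm E2 = 1 \<and> orthogonal E1 E2"

definition normal_curvature ::
  "patch \<Rightarrow> real \<Rightarrow> real \<Rightarrow> real^4 \<Rightarrow> real^4 \<Rightarrow> real^4 \<Rightarrow> real^4 \<Rightarrow> real" where
  "normal_curvature X u v X1 X2 N1 N2 =
     sqrt ((normal_curvature_tensor X u v X1 X2 N1 \<bullet> N2)\<^sup>2)"

definition flat_normal_connection :: "patch \<Rightarrow> real set \<Rightarrow> real set \<Rightarrow> bool" where
  "flat_normal_connection X I J \<longleftrightarrow>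
     (\<forall>u\<in>I. \<forall>v\<in>J. \<forall>Y\<in>tangent_plane X u v. \<forall>Z\<in>tangent_plane X u v.
        \<forall>N\<in>normal_plane X u v. normal_curvature_tensor X u v Y Z N = 0)"

definition generalized_spherical_surface_first_kind ::
  "real \<Rightarrow> real \<Rightarrow> (real \<Rightarrow> real) \<Rightarrow> real set \<Rightarrow> patch \<Rightarrow> bool" where
  "generalized_spherical_surface_first_kind c lam \<alpha> I X \<longleftrightarrow>
     (\<exists>f1 f2.
        (\<forall>u\<in>I. (f1 has_real_derivative
            sqrt (1 - lam\<^sup>2 / c\<^sup>2 * (sin (u / c))\<^sup>2) * cos (\<alpha> u)) (at u)) \<and>
        (\<forall>u\<in>I. (f2 has_real_derivative
            sqrt (1 - lam\<^sup>2 / c\<^sup>2 * (sin (u / c))\<^sup>2) * sin (\<alpha> u)) (at u)) \<and>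
        (\<forall>u\<in>I. \<forall>v. X u v =
            vector [f1 u, f2 u, lam * cos (u / c) * cos v, lam * cos (u / c) * sin v]))"

end

theory Submission
  imports Defs
begin

text \<open>
  The normal curvature tensor measures the failure of the shape operators to be diagonal in a
  common orthogonal tangent basis. If \<open>X\<^sub>u\<close> and \<open>X\<^sub>v\<close> are nonzero and orthogonal and
  the mixed coefficient \<open>h(X\<^sub>u, X\<^sub>v)\<close> vanishes, then \<open>h\<close> is diagonal in this basis, so
  every \<open>A\<^sub>N\<close> multiplies the two coordinates of a tangent vector by fixed factors, and
  \<open>h(Y, A\<^sub>N Z)\<close> becomes symmetric in \<open>Y\<close> and \<open>Z\<close>; hence \<open>R\<^sup>\<bottom> = 0\<close>
  (lemma \<open>normal_curvature_tensor_eq_0\<close>).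

  A generalized spherical surface is of this kind because it is a rotation surface. The
  meridian part \<open>(f\<^sub>1, f\<^sub>2)\<close> depends on \<open>u\<close> alone, so \<open>X\<^sub>v\<close> is the tangent of
  the parallel circle of radius \<open>\<lambda> cos (u/c)\<close>. Differentiating it in \<open>u\<close> changes only
  that radius, so \<open>X\<^sub>u\<^sub>v\<close> is a multiple of \<open>X\<^sub>v\<close> and has no normal part. The factor
  under the root in \<open>f\<^sub>1'\<close> and \<open>f\<^sub>2'\<close> is chosen so that the meridians have unit
  speed, and \<open>X\<^sub>v\<close> does not vanish because \<open>cos (u/c)\<close> does not. Lemma
  \<open>rotation_patch_normal_curvature_tensor\<close> carries this out for an arbitrary radius function.
\<close>

section \<open>The normal projection\<close>

lemma normal_planeD:
  assumes "n \<in> normal_plane X u v" "t \<in> tangent_plane X u v"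
  shows "t \<bullet> n = 0"
  using assms by (simp add: normal_plane_def orthogonal_comp_def orthogonal_def)

lemma subspace_tangent_plane: "subspace (tangent_plane X u v)"
  by (simp add: tangent_plane_def)

lemma subspace_normal_plane: "subspace (normal_plane X u v)"
  by (simp add: normal_plane_def subspace_orthogonal_comp)

lemma normal_part_eqI:
  assumes "n \<in> normal_plane X u v" "w - n \<in> tangent_plane X u v"
  shows "normal_part X u v w = n"
  unfolding normal_part_def
proof (rule the_equality)
  fix m assume m: "m \<in> normal_plane X u v \<and> w - m \<in> tangent_plane X u v"
  have "(w - n) - (w - m) \<in> tangent_plane X u v"
    using m assms(2) subspace_tangent_plane by (blast intro: subspace_diff)
  then have "m - n \<in> tangent_plane X u v" by simp
  moreover have "m - n \<in> normal_plane X u v"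
    using m assms(1) subspace_normal_plane by (blast intro: subspace_diff)
  ultimately have "(m - n) \<bullet> (m - n) = 0" by (metis normal_planeD)
  then show "m = n" by simp
qed (use assms in simp)

lemma normal_part_props:
  "normal_part X u v w \<in> normal_plane X u v" (is ?A)
  "w - normal_part X u v w \<in> tangent_plane X u v" (is ?B)
proof -
  obtain y z where "y \<in> tangent_plane X u v"
    and z: "\<And>t. t \<in> tangent_plane X u v \<Longrightarrow> orthogonal z t" and "w = y + z"
    using orthogonal_subspace_decomp_exists[of "{partial_u X u v, partial_v X u v}" w]
    unfolding tangent_plane_def by blast
  moreover have "z \<in> normal_plane X u v"
    using z by (simp add: normal_plane_def orthogonal_comp_def orthogonal_commute)
  ultimately show ?A ?B using normal_part_eqI[of z X u v w] by simp_all
qed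

lemma normal_part_tangent:
  assumes "w \<in> tangent_plane X u v"
  shows "normal_part X u v w = 0"
  by (rule normal_part_eqI) (use assms subspace_0[OF subspace_normal_plane] in simp_all)

lemma linear_normal_part: "linear (normal_part X u v)"
proof (rule linearI)
  fix x y :: "real^4" and r :: real
  have "(x - normal_part X u v x) + (y - normal_part X u v y) \<in> tangent_plane X u v"
    by (intro subspace_add subspace_tangent_plane normal_part_props)
  then show "normal_part X u v (x + y) = normal_part X u v x + normal_part X u v y"
    by (intro normal_part_eqI subspace_add subspace_normal_plane normal_part_props)
       (simp add: algebra_simps)
  have "r *\<^sub>R (x - normal_part X u v x) \<in> tangent_plane X u v"
    by (intro subspace_scale subspace_tangent_plane normal_part_props)
  then show "normal_part X u v (r *\<^sub>R x) = r *\<^sub>R normal_part X u v x"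
    by (intro normal_part_eqI subspace_scale subspace_normal_plane normal_part_props)
       (simp add: algebra_simps)
qed

section \<open>Diagonal second fundamental forms\<close>

lemma tangent_plane_iff:
  "Y \<in> tangent_plane X u v \<longleftrightarrow> (\<exists>a b. Y = a *\<^sub>R partial_u X u v + b *\<^sub>R partial_v X u v)"
  by (auto simp: tangent_plane_def span_insert span_singleton algebra_simps)

lemma tangent_coords_eq:
  assumes "partial_u X u v \<noteq> 0" "partial_v X u v \<noteq> 0" "partial_u X u v \<bullet> partial_v X u v = 0"
  shows "tangent_coords X u v (a *\<^sub>R partial_u X u v + b *\<^sub>R partial_v X u v) = (a, b)"
proof -
  let ?U = "partial_u X u v" and ?V = "partial_v X u v"
  have "a = p \<and> b = q" if eq: "a *\<^sub>R ?U + b *\<^sub>R ?V = p *\<^sub>R ?U + q *\<^sub>R ?V" for p q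
  proof -
    have "(a *\<^sub>R ?U + b *\<^sub>R ?V) \<bullet> ?U = (p *\<^sub>R ?U + q *\<^sub>R ?V) \<bullet> ?U"
      "(a *\<^sub>R ?U + b *\<^sub>R ?V) \<bullet> ?V = (p *\<^sub>R ?U + q *\<^sub>R ?V) \<bullet> ?V"
      using eq by simp_all
    then show ?thesis
      using assms by (simp add: inner_add_left inner_commute[of ?V ?U])
  qed
  then show ?thesis
    unfolding tangent_coords_def by (intro the_equality) auto
qed

lemma shape_operator_eqI:
  assumes "W \<in> tangent_plane X u v"
    and "\<And>Z. Z \<in> tangent_plane X u v \<Longrightarrow> W \<bullet> Z = second_fundamental_form X u v Y Z \<bullet> N"
  shows "shape_operator X u v N Y = W"
  unfolding shape_operator_def
proof (rule the_equality)
  fix W' assume W': "W' \<in> tangent_plane X u v \<and>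
    (\<forall>Z\<in>tangent_plane X u v. W' \<bullet> Z = second_fundamental_form X u v Y Z \<bullet> N)"
  have "W' - W \<in> tangent_plane X u v"
    using W' assms(1) subspace_tangent_plane by (blast intro: subspace_diff)
  then have "(W' - W) \<bullet> (W' - W) = 0"
    using W' assms(2) by (simp add: inner_diff_left)
  then show "W' = W" by simp
qed (use assms in simp)

text \<open>The mixed derivatives enter only through their normal parts, which vanish when they are
  tangent.\<close>

lemma second_fundamental_form_diagonal:
  assumes "partial_u X u v \<noteq> 0" "partial_v X u v \<noteq> 0" "partial_u X u v \<bullet> partial_v X u v = 0"
    and "partial_u (partial_v X) u v \<in> tangent_plane X u v"
    and "partial_v (partial_u X) u v \<in> tangent_plane X u v"
  shows "second_fundamental_form X u v (a *\<^sub>R partial_u X u v + b *\<^sub>R partial_v X u v)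
           (p *\<^sub>R partial_u X u v + q *\<^sub>R partial_v X u v) =
         (a * p) *\<^sub>R normal_part X u v (partial_u (partial_u X) u v) +
         (b * q) *\<^sub>R normal_part X u v (partial_v (partial_v X) u v)"
  unfolding second_fundamental_form_def
  using assms(4,5)
  by (simp add: tangent_coords_eq[OF assms(1-3)] normal_part_tangent
      linear_add[OF linear_normal_part] linear_scale[OF linear_normal_part])

lemma shape_operator_diagonal:
  assumes "partial_u X u v \<noteq> 0" "partial_v X u v \<noteq> 0" "partial_u X u v \<bullet> partial_v X u v = 0"
    and "partial_u (partial_v X) u v \<in> tangent_plane X u v"
    and "partial_v (partial_u X) u v \<in> tangent_plane X u v"
  shows "shape_operator X u v N (p *\<^sub>R partial_u X u v + q *\<^sub>R partial_v X u v) =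
    (p * (normal_part X u v (partial_u (partial_u X) u v) \<bullet> N /
       (partial_u X u v \<bullet> partial_u X u v))) *\<^sub>R partial_u X u v +
    (q * (normal_part X u v (partial_v (partial_v X) u v) \<bullet> N /
       (partial_v X u v \<bullet> partial_v X u v))) *\<^sub>R partial_v X u v"
    (is "_ = ?W")
proof (rule shape_operator_eqI)
  show "?W \<in> tangent_plane X u v" by (auto simp: tangent_plane_iff)
  fix Z assume "Z \<in> tangent_plane X u v"
  then obtain a b where Z: "Z = a *\<^sub>R partial_u X u v + b *\<^sub>R partial_v X u v"
    by (auto simp: tangent_plane_iff)
  show "?W \<bullet> Z = second_fundamental_form X u v
      (p *\<^sub>R partial_u X u v + q *\<^sub>R partial_v X u v) Z \<bullet> N"
    unfolding Z second_fundamental_form_diagonal[OF assms]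
    using assms(1-3)
    by (simp add: inner_add_left inner_add_right inner_commute[of "partial_v X u v" "partial_u X u v"]
        algebra_simps)
qed

text \<open>This is the case of the Ricci equation in which the shape operators commute: with
  \<open>Y = (a, b)\<close> and \<open>Z = (p, q)\<close>, the vector \<open>h(Y, A\<^sub>N Z)\<close> depends on \<open>Y\<close> and \<open>Z\<close> only
  through the products \<open>a p\<close> and \<open>b q\<close>.\<close>

lemma normal_curvature_tensor_eq_0:
  assumes "partial_u X u v \<noteq> 0" "partial_v X u v \<noteq> 0" "partial_u X u v \<bullet> partial_v X u v = 0"
    and "partial_u (partial_v X) u v \<in> tangent_plane X u v"
    and "partial_v (partial_u X) u v \<in> tangent_plane X u v"
    and "Y \<in> tangent_plane X u v" "Z \<in> tangent_plane X u v"
  shows "normal_curvature_tensor X u v Y Z N = 0"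
proof -
  obtain a b where Y: "Y = a *\<^sub>R partial_u X u v + b *\<^sub>R partial_v X u v"
    using assms(6) by (auto simp: tangent_plane_iff)
  obtain p q where Z: "Z = p *\<^sub>R partial_u X u v + q *\<^sub>R partial_v X u v"
    using assms(7) by (auto simp: tangent_plane_iff)
  show ?thesis
    unfolding normal_curvature_tensor_def Y Z shape_operator_diagonal[OF assms(1-5)]
      second_fundamental_form_diagonal[OF assms(1-5)]
    by (simp add: mult_ac)
qed

section \<open>Partial derivatives of rotation surfaces\<close>

lemma vector_4:
  "(vector [a, b, c, d] :: 'a::zero ^ 4) $ 1 = a"
  "(vector [a, b, c, d] :: 'a::zero ^ 4) $ 2 = b"
  "(vector [a, b, c, d] :: 'a::zero ^ 4) $ 3 = c"
  "(vector [a, b, c, d] :: 'a::zero ^ 4) $ 4 = d"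
  by (simp_all add: vector_def)

lemma has_vector_derivative_vector4:
  fixes a b c d :: "real \<Rightarrow> real"
  assumes "(a has_real_derivative a') (at x)" "(b has_real_derivative b') (at x)"
    "(c has_real_derivative c') (at x)" "(d has_real_derivative d') (at x)"
  shows "((\<lambda>x. vector [a x, b x, c x, d x] :: real^4) has_vector_derivative
           vector [a', b', c', d']) (at x)"
proof -
  have *: "(vector [p, q, r, s] :: real^4) =
      p *\<^sub>R axis 1 1 + q *\<^sub>R axis 2 1 + r *\<^sub>R axis 3 1 + s *\<^sub>R axis 4 1" for p q r s
    by (simp add: vec_eq_iff forall_4 vector_4 axis_def)
  have **: "((\<lambda>x. g x *\<^sub>R e) has_vector_derivative g' *\<^sub>R e) (at x)"
    if "(g has_real_derivative g') (at x)" for g :: "real \<Rightarrow> real" and g' and e :: "real^4"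
    using has_vector_derivative_scaleR[OF that has_vector_derivative_const[of e]] by simp
  show ?thesis
    unfolding * by (intro has_vector_derivative_add ** assms)
qed

lemma inner_vector4:
  "(vector [a, b, c, d] :: real^4) \<bullet> vector [a', b', c', d'] = a * a' + b * b' + c * c' + d * d'"
  by (simp add: inner_vec_def sum_4 vector_4)

text \<open>Only the values of \<open>X\<close> over the open set \<open>I\<close> are known, so a derivative in \<open>u\<close> is
  computed from a function that agrees with the given one near \<open>u\<close>.\<close>

lemma partial_u_eqI:
  assumes "open I" "u \<in> I" "\<And>s. s \<in> I \<Longrightarrow> F s v = g s" "(g has_vector_derivative D) (at u)"
  shows "partial_u F u v = D"
  unfolding partial_u_def
  by (rule vector_derivative_at, rule has_vector_derivative_transform_within_open[OF assms(4,1,2)])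
     (simp add: assms(3))

lemma partial_v_eqI:
  assumes "\<And>t. F u t = g t" "(g has_vector_derivative D) (at v)"
  shows "partial_v F u v = D"
  using assms(2) by (simp add: partial_v_def assms(1) vector_derivative_at)

locale rotation_patch =
  fixes X :: patch and I :: "real set" and f1 f2 r f1' f2' r' :: "real \<Rightarrow> real"
  assumes open_I: "open I"
    and f1: "\<And>u. u \<in> I \<Longrightarrow> (f1 has_real_derivative f1' u) (at u)"
    and f2: "\<And>u. u \<in> I \<Longrightarrow> (f2 has_real_derivative f2' u) (at u)"
    and r: "\<And>u. u \<in> I \<Longrightarrow> (r has_real_derivative r' u) (at u)"
    and X: "\<And>u v. u \<in> I \<Longrightarrow> X u v = vector [f1 u, f2 u, r u * cos v, r u * sin v]"
begin

lemma partial_u_X: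
  assumes "u \<in> I"
  shows "partial_u X u v = vector [f1' u, f2' u, r' u * cos v, r' u * sin v]"
  by (rule partial_u_eqI[where I = I, OF open_I assms X has_vector_derivative_vector4])
     (auto intro!: derivative_eq_intros f1 f2 r assms)

lemma partial_v_X:
  assumes "u \<in> I"
  shows "partial_v X u v = vector [0, 0, - r u * sin v, r u * cos v]"
  by (rule partial_v_eqI, rule X[OF assms], rule has_vector_derivative_vector4)
     (auto intro!: derivative_eq_intros)

lemma partial_u_partial_v_X:
  assumes "u \<in> I"
  shows "partial_u (partial_v X) u v = vector [0, 0, - r' u * sin v, r' u * cos v]"
  by (rule partial_u_eqI[where I = I, OF open_I assms partial_v_X has_vector_derivative_vector4])
     (auto intro!: derivative_eq_intros r assms)

lemma partial_v_partial_u_X: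
  assumes "u \<in> I"
  shows "partial_v (partial_u X) u v = vector [0, 0, - r' u * sin v, r' u * cos v]"
  by (rule partial_v_eqI, rule partial_u_X[OF assms], rule has_vector_derivative_vector4)
     (auto intro!: derivative_eq_intros)

lemma inner_partial_u_X:
  assumes "u \<in> I"
  shows "partial_u X u v \<bullet> partial_u X u v = (f1' u)\<^sup>2 + (f2' u)\<^sup>2 + (r' u)\<^sup>2"
proof -
  have "partial_u X u v \<bullet> partial_u X u v =
      (f1' u)\<^sup>2 + (f2' u)\<^sup>2 + (r' u)\<^sup>2 * ((cos v)\<^sup>2 + (sin v)\<^sup>2)"
    by (simp only: partial_u_X[OF assms] inner_vector4) algebra
  then show ?thesis by simp
qed

lemma inner_partial_v_X:
  assumes "u \<in> I"
  shows "partial_v X u v \<bullet> partial_v X u v = (r u)\<^sup>2"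
proof -
  have "partial_v X u v \<bullet> partial_v X u v = (r u)\<^sup>2 * ((cos v)\<^sup>2 + (sin v)\<^sup>2)"
    by (simp only: partial_v_X[OF assms] inner_vector4) algebra
  then show ?thesis by simp
qed

text \<open>Both mixed derivatives are \<open>r'/r\<close> times \<open>X\<^sub>v\<close>, hence tangent.\<close>

lemma rotation_patch_normal_curvature_tensor:
  assumes "u \<in> I" "r u \<noteq> 0" "(f1' u)\<^sup>2 + (f2' u)\<^sup>2 + (r' u)\<^sup>2 \<noteq> 0"
    and "Y \<in> tangent_plane X u v" "Z \<in> tangent_plane X u v"
  shows "normal_curvature_tensor X u v Y Z N = 0"
proof (rule normal_curvature_tensor_eq_0)
  show "partial_u X u v \<noteq> 0" "partial_v X u v \<noteq> 0"
    using assms(2,3) inner_partial_u_X[OF assms(1), of v] inner_partial_v_X[OF assms(1), of v]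
    by auto
  show "partial_u X u v \<bullet> partial_v X u v = 0"
    by (simp add: partial_u_X partial_v_X assms(1) inner_vector4)
  have "vector [0, 0, - r' u * sin v, r' u * cos v] = (r' u / r u) *\<^sub>R partial_v X u v"
    using assms(1,2) by (simp add: partial_v_X vec_eq_iff forall_4 vector_4)
  also have "\<dots> \<in> tangent_plane X u v"
    unfolding tangent_plane_def by (intro span_mul span_base) simp
  finally show "partial_u (partial_v X) u v \<in> tangent_plane X u v"
    "partial_v (partial_u X) u v \<in> tangent_plane X u v"
    by (simp_all add: partial_u_partial_v_X partial_v_partial_u_X assms(1))
qed fact+

end

section \<open>Generalized spherical surfaces\<close>

theorem corollary10:
  fixes c lam :: real and I :: "real set" and \<alpha> :: "real \<Rightarrow> real" and X :: patch
  assumes "c \<noteq> 0" and "lam > 0"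
    and "open I" and "is_interval I"
    and "\<And>u. u \<in> I \<Longrightarrow> cos (u / c) \<noteq> 0"
    and "\<And>u. u \<in> I \<Longrightarrow> 1 - lam\<^sup>2 / c\<^sup>2 * (sin (u / c))\<^sup>2 > 0"
    and "smooth_on \<alpha> I"
    and "generalized_spherical_surface_first_kind c lam \<alpha> I X"
  shows "flat_normal_connection X I UNIV \<and>
    (\<forall>u\<in>I. \<forall>v X1 X2 N1 N2.
       orthonormal_frame (tangent_plane X u v) X1 X2 \<longrightarrow>
       orthonormal_frame (normal_plane X u v) N1 N2 \<longrightarrow>
       normal_curvature X u v X1 X2 N1 N2 = 0)"
proof -
  let ?w = "\<lambda>u. 1 - lam\<^sup>2 / c\<^sup>2 * (sin (u / c))\<^sup>2"
  let ?r' = "\<lambda>u. - (lam / c) * sin (u / c)"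
  obtain f1 f2 where
    f1: "\<And>u. u \<in> I \<Longrightarrow> (f1 has_real_derivative sqrt (?w u) * cos (\<alpha> u)) (at u)"
    and f2: "\<And>u. u \<in> I \<Longrightarrow> (f2 has_real_derivative sqrt (?w u) * sin (\<alpha> u)) (at u)"
    and X: "\<And>u v. u \<in> I \<Longrightarrow>
      X u v = vector [f1 u, f2 u, lam * cos (u / c) * cos v, lam * cos (u / c) * sin v]"
    using assms(8) unfolding generalized_spherical_surface_first_kind_def by metis
  interpret rotation_patch X I f1 f2 "\<lambda>u. lam * cos (u / c)"
    "\<lambda>u. sqrt (?w u) * cos (\<alpha> u)" "\<lambda>u. sqrt (?w u) * sin (\<alpha> u)" ?r'
    by unfold_locales
       (use assms(1,3) f1 f2 X in \<open>auto intro!: derivative_eq_intros\<close>)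
  have R: "normal_curvature_tensor X u v Y Z N = 0"
    if u: "u \<in> I" and "Y \<in> tangent_plane X u v" "Z \<in> tangent_plane X u v" for u v Y Z N
  proof (rule rotation_patch_normal_curvature_tensor)
    show "lam * cos (u / c) \<noteq> 0" using assms(2,5) u by simp
    have "(sqrt (?w u) * cos (\<alpha> u))\<^sup>2 + (sqrt (?w u) * sin (\<alpha> u))\<^sup>2 =
        ?w u * ((cos (\<alpha> u))\<^sup>2 + (sin (\<alpha> u))\<^sup>2)"
      using assms(6)[OF u] by (simp only: power_mult_distrib real_sqrt_pow2 less_imp_le distrib_left)
    \<comment> \<open>The radius contributes exactly the speed that the root removes, so the meridians have
      unit speed.\<close>
    then have "(sqrt (?w u) * cos (\<alpha> u))\<^sup>2 + (sqrt (?w u) * sin (\<alpha> u))\<^sup>2 + (?r' u)\<^sup>2 = 1"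
      by (simp add: power_mult_distrib power_divide)
    then show "(sqrt (?w u) * cos (\<alpha> u))\<^sup>2 + (sqrt (?w u) * sin (\<alpha> u))\<^sup>2 + (?r' u)\<^sup>2 \<noteq> 0"
      by simp
  qed fact+
  then show ?thesis
    by (simp add: flat_normal_connection_def normal_curvature_def orthonormal_frame_def)
qed

end
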